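(* Let $(A,\mathbb{G})$ be a graph-partitioned matrix, where $\mathbb{G}$ admits a Hamiltonian path, possessing a $\mathbb{G}$-semi-separable representation with state dimensions $r^g_i,r^h_i$ ($i$ a vertex of $\mathbb{G}$), and define the maximal state dimension $r=\max_{i}\{r^g_i,r^h_i\}$, the maximum being over all vertices $i$ of $\mathbb{G}$. Then $(A,\mathbb{G})$ is GIRS-$4r$.
   Context: A graph-partitioned matrix $(A,\mathbb{G})$ consists of a finite undirected graph $\mathbb{G}$ with vertex set $\{1,\ldots,n\}$, block sizes $N_1,\ldots,N_n$, and $A\in\mathbb{R}^{N\times N}$, $N=\sum_iN_i$, partitioned into blocks $A_{ij}\in\mathbb{R}^{N_i\times N_j}$. $\mathbb{G}$-semi-separable representation: Fix a Hamiltonian path of $\mathbb{G}$; it induces a total order $\prec$ on the vertices ($u\prec v$ iff $u$ comes before $v$ along the path). For a vertex $i$ let $\mathbb{P}_u(i)=\{j:\{i,j\}\text{ is an edge of }\mathbb{G},\ j\prec i\}$ and $\mathbb{P}_d(i)=\{j:\{i,j\}\text{ is an edge of }\mathbb{G},\ j\succ i\}$. A $\mathbb{G}$-semi-separable representation of $A$ with state dimensions $r^g_i,r^h_i\ge0$ is a collection of real matrices $V_i$ ($N_i\times r^g_i$), $W_{i,j}$ ($r^g_i\times r^g_j$), $Q_i$ ($N_i\times r^h_i$), $R_{i,j}$ ($r^h_i\times r^h_j$), $D_i$ ($N_i\times N_i$), $U_{i,j}$ ($N_i\times r^g_j$), $P_{i,j}$ ($N_i\times r^h_j$) such that for every choice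 of $x_j\in\mathbb{R}^{N_j}$ ($j=1,\dots,n$), the vectors $g_i\in\mathbb{R}^{r^g_i}$, $h_i\in\mathbb{R}^{r^h_i}$, $b_i\in\mathbb{R}^{N_i}$ determined by $$g_i=V_i^Tx_i+\sum_{j\in\mathbb{P}_d(i)}W_{i,j}g_j,\quad h_i=Q_i^Tx_i+\sum_{j\in\mathbb{P}_u(i)}R_{i,j}h_j,\quad b_i=D_ix_i+\sum_{j\in\mathbb{P}_d(i)}U_{i,j}g_j+\sum_{j\in\mathbb{P}_u(i)}P_{i,j}h_j$$ satisfy $b_i=\sum_{j=1}^nA_{ij}x_j$ for all $i$. GIRS: for an induced subgraph $\mathbb{H}$ of $\mathbb{G}$, $\overline{\mathbb{H}}$ is the induced subgraph on the complementary vertex set, $A_{\overline{\mathbb{H}},\mathbb{H}}$ is the submatrix formed by the blocks $A_{ij}$ with $i$ in $\overline{\mathbb{H}}$ and $j$ in $\mathbb{H}$, and $\rho(\mathbb{H})$ is the number of edges of $\mathbb{G}$ between $\mathbb{H}$ and $\overline{\mathbb{H}}$. For a constant $c\ge0$, $(A,\mathbb{G})$ is GIRS-$c$ if $\operatorname{rank}(A_{\overline{\mathbb{H}},\mathbb{H}})\le c\,\rho(\mathbb{H})$ for all induced subgraphs $\mathbb{H}$. *)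

theory Defs
  imports
    "Graph_Theory.Graph_Theory"
    "Jordan_Normal_Form.DL_Rank"
    "Jordan_Normal_Form.DL_Submatrix"
begin

text \<open>
  A finite simple undirected graph is a \<open>pair_graph\<close>: the undirected edge \<open>{i, j}\<close> is the
  pair of arcs \<open>(i, j)\<close> and \<open>(j, i)\<close>.  Vertices are numbered from \<open>1\<close>, whereas rows and columns
  of a matrix are numbered from \<open>0\<close>; hence vertex \<open>i\<close> owns the row (and column) indices
  \<open>N 1 + ... + N (i - 1) ..< N 1 + ... + N i\<close>.
\<close>

definition block_indices :: "(nat \<Rightarrow> nat) \<Rightarrow> nat \<Rightarrow> nat set" where
  "block_indices N i = {(\<Sum>k\<in>{1..<i}. N k) ..< (\<Sum>k\<in>{1..i}. N k)}"

definition block :: "(nat \<Rightarrow> nat) \<Rightarrow> real mat \<Rightarrow> nat \<Rightarrow> nat \<Rightarrow> real mat" where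
  "block N A i j = submatrix A (block_indices N i) (block_indices N j)"

definition block_submatrix :: "(nat \<Rightarrow> nat) \<Rightarrow> real mat \<Rightarrow> nat set \<Rightarrow> nat set \<Rightarrow> real mat" where
  "block_submatrix N A I J =
     submatrix A (\<Union>i\<in>I. block_indices N i) (\<Union>j\<in>J. block_indices N j)"

definition mat_rank :: "real mat \<Rightarrow> nat" where
  "mat_rank M = vec_space.rank (dim_row M) M"

definition graph_partitioned_matrix ::
    "nat \<Rightarrow> nat pair_pre_digraph \<Rightarrow> (nat \<Rightarrow> nat) \<Rightarrow> real mat \<Rightarrow> bool" where
  "graph_partitioned_matrix n G N A \<longleftrightarrow>
     pair_graph G \<and> pverts G = {1..n} \<and>
     A \<in> carrier_mat (\<Sum>i\<in>{1..n}. N i) (\<Sum>i\<in>{1..n}. N i)"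

definition hamiltonian_path :: "nat pair_pre_digraph \<Rightarrow> nat list \<Rightarrow> bool" where
  "hamiltonian_path G p \<longleftrightarrow> vpath p (with_proj G) \<and> set p = pverts G"

definition before :: "nat list \<Rightarrow> nat \<Rightarrow> nat \<Rightarrow> bool" where
  "before p u v \<longleftrightarrow> (\<exists>k l. k < l \<and> l < length p \<and> p ! k = u \<and> p ! l = v)"

definition P_u :: "nat pair_pre_digraph \<Rightarrow> nat list \<Rightarrow> nat \<Rightarrow> nat set" where
  "P_u G p i = {j. (i, j) \<in> parcs G \<and> before p j i}"

definition P_d :: "nat pair_pre_digraph \<Rightarrow> nat list \<Rightarrow> nat \<Rightarrow> nat set" where
  "P_d G p i = {j. (i, j) \<in> parcs G \<and> before p i j}"

abbreviation vsum :: "nat \<Rightarrow> (nat \<Rightarrow> real vec) \<Rightarrow> nat set \<Rightarrow> real vec" where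
  "vsum \<equiv> finsum_vec TYPE(real)"

text \<open>
  For a Hamiltonian path \<open>p\<close> the equations for \<open>g\<close>, \<open>h\<close> and \<open>b\<close> are recursions along the finite
  order \<open>before p\<close> (backwards for \<open>g\<close>, forwards for \<open>h\<close>), so for every \<open>x\<close> they have exactly one
  solution on the vertices; the universal quantification over \<open>g h b\<close> below therefore speaks
  about that solution and is never vacuous.
\<close>

definition semi_separable_representation ::
    "nat \<Rightarrow> nat pair_pre_digraph \<Rightarrow> (nat \<Rightarrow> nat) \<Rightarrow> real mat \<Rightarrow> nat list \<Rightarrow>
     (nat \<Rightarrow> nat) \<Rightarrow> (nat \<Rightarrow> nat) \<Rightarrow>
     (nat \<Rightarrow> real mat) \<Rightarrow> (nat \<Rightarrow> nat \<Rightarrow> real mat) \<Rightarrow>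
     (nat \<Rightarrow> real mat) \<Rightarrow> (nat \<Rightarrow> nat \<Rightarrow> real mat) \<Rightarrow>
     (nat \<Rightarrow> real mat) \<Rightarrow> (nat \<Rightarrow> nat \<Rightarrow> real mat) \<Rightarrow> (nat \<Rightarrow> nat \<Rightarrow> real mat) \<Rightarrow> bool" where
  "semi_separable_representation n G N A p rg rh V W Q R D U P \<longleftrightarrow>
     hamiltonian_path G p \<and>
     (\<forall>i\<in>{1..n}.
        V i \<in> carrier_mat (N i) (rg i) \<and>
        Q i \<in> carrier_mat (N i) (rh i) \<and>
        D i \<in> carrier_mat (N i) (N i) \<and>
        (\<forall>j\<in>P_d G p i. W i j \<in> carrier_mat (rg i) (rg j) \<and> U i j \<in> carrier_mat (N i) (rg j)) \<and>
        (\<forall>j\<in>P_u G p i. R i j \<in> carrier_mat (rh i) (rh j) \<and> P i j \<in> carrier_mat (N i) (rh j))) \<and>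
     (\<forall>x g h b.
        (\<forall>i\<in>{1..n}.
           x i \<in> carrier_vec (N i) \<and> g i \<in> carrier_vec (rg i) \<and>
           h i \<in> carrier_vec (rh i) \<and> b i \<in> carrier_vec (N i)) \<longrightarrow>
        (\<forall>i\<in>{1..n}.
           g i = (V i)\<^sup>T *\<^sub>v x i + vsum (rg i) (\<lambda>j. W i j *\<^sub>v g j) (P_d G p i) \<and>
           h i = (Q i)\<^sup>T *\<^sub>v x i + vsum (rh i) (\<lambda>j. R i j *\<^sub>v h j) (P_u G p i) \<and>
           b i = D i *\<^sub>v x i + vsum (N i) (\<lambda>j. U i j *\<^sub>v g j) (P_d G p i)
                             + vsum (N i) (\<lambda>j. P i j *\<^sub>v h j) (P_u G p i)) \<longrightarrow>
        (\<forall>i\<in>{1..n}. b i = vsum (N i) (\<lambda>j. block N A i j *\<^sub>v x j) {1..n}))"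

text \<open>
  An undirected edge between \<open>H\<close> and its complement contributes exactly one arc that leaves \<open>H\<close>,
  so counting those arcs counts undirected edges.
\<close>

definition cut_edges :: "nat pair_pre_digraph \<Rightarrow> (nat, nat \<times> nat) pre_digraph \<Rightarrow> nat" where
  "cut_edges G H = card {(i, j) \<in> parcs G. i \<in> verts H \<and> j \<in> pverts G - verts H}"

definition GIRS ::
    "nat pair_pre_digraph \<Rightarrow> (nat \<Rightarrow> nat) \<Rightarrow> real mat \<Rightarrow> real \<Rightarrow> bool" where
  "GIRS G N A c \<longleftrightarrow> 0 \<le> c \<and>
     (\<forall>H. induced_subgraph H (with_proj G) \<longrightarrow>
        real (mat_rank (block_submatrix N A (pverts G - verts H) (verts H)))
          \<le> c * real (cut_edges G H))"

end

theory Submission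
  imports Defs "Jordan_Normal_Form.Matrix_Kernel"
begin

text \<open>
  Feed the representation with an input supported on \<open>H\<close>.  The states at vertices outside \<open>H\<close>, and
  hence the outputs there, depend on the input only through the states at those vertices of \<open>H\<close>
  that have a neighbour outside \<open>H\<close>: if these boundary states vanish, recursion along the path
  shows that all states and outputs outside \<open>H\<close> vanish.  So the kernel of the off-diagonal
  submatrix contains the kernel of the map from inputs to boundary states, and its rank is at
  most the total dimension of the boundary states.  There are at most as many boundary vertices
  as cut edges, each with states of total dimension at most \<open>2 r\<close>.
\<close>

section \<open>Rank bounds from kernel inclusions\<close>

lemma index_mult_mat_vec_sum:
  assumes "B \<in> carrier_mat m k" "w \<in> carrier_vec k" "a < m"
  shows "(B *\<^sub>v w) $ a = (\<Sum>b\<in>{0..<k}. B $$ (a, b) * w $ b)"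
  using assms by (simp add: scalar_prod_def)

lemma mult_mat_zero_vec:
  fixes B :: "'a :: semiring_0 mat"
  assumes "B \<in> carrier_mat m k"
  shows "B *\<^sub>v 0\<^sub>v k = 0\<^sub>v m"
  using assms by (intro eq_vecI) auto

text \<open>Padding \<open>F\<close> with zero rows to a square matrix makes it singular, and a
  kernel vector of the padded matrix is one of \<open>F\<close>.\<close>

lemma wide_mat_kernel_nontrivial:
  fixes F :: "'a :: field mat"
  assumes F: "F \<in> carrier_mat k m" and "k < m"
  obtains v where "v \<in> carrier_vec m" "v \<noteq> 0\<^sub>v m" "F *\<^sub>v v = 0\<^sub>v k"
proof -
  define Z where "Z = mat m m (\<lambda>(i, j). if i < k then F $$ (i, j) else 0)"
  have Z: "Z \<in> carrier_mat m m" by (simp add: Z_def)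
  \<comment> \<open>Row \<open>k\<close> is the first padded row of \<open>Z\<close>; it exists
    because \<open>k < m\<close>.\<close>
  have "Z\<^sup>T *\<^sub>v unit_vec m k = 0\<^sub>v m"
    using \<open>k < m\<close> by (intro eq_vecI) (auto simp: Z_def)
  moreover have "unit_vec m k \<noteq> (0\<^sub>v m :: 'a vec)"
    using \<open>k < m\<close> by (metis index_unit_vec(1) index_zero_vec(1) zero_neq_one)
  ultimately have "det Z\<^sup>T = 0"
    using det_0_iff_vec_prod_zero_field[of "Z\<^sup>T" m] Z
    by (metis transpose_carrier_mat unit_vec_carrier)
  then obtain v where v: "v \<in> carrier_vec m" "v \<noteq> 0\<^sub>v m" "Z *\<^sub>v v = 0\<^sub>v m"
    using det_0_iff_vec_prod_zero_field[OF Z] Z by (auto simp: det_transpose)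
  have "F *\<^sub>v v = 0\<^sub>v k"
  proof (rule eq_vecI)
    fix i assume i: "i < dim_vec (0\<^sub>v k :: 'a vec)"
    then have "row F i = row Z i"
      using F \<open>k < m\<close> by (intro eq_vecI) (auto simp: Z_def)
    then show "(F *\<^sub>v v) $ i = 0\<^sub>v k $ i"
      using i F Z \<open>k < m\<close> arg_cong[OF v(3), of "\<lambda>w. w $ i"] by simp
  qed (use F in simp)
  with v show ?thesis using that by blast
qed

text \<open>If more than \<open>k\<close> columns of \<open>A\<close> were independent, the
  corresponding columns of \<open>F\<close> would form a wide matrix with a nonzero kernel vector.
  Its coefficients give a vector in the kernel of \<open>F\<close>, hence of \<open>A\<close>, which
  is a nontrivial relation between independent columns.\<close>

lemma (in vec_space) rank_le_of_mat_kernel_subset: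
  assumes A: "A \<in> carrier_mat n nc" and F: "F \<in> carrier_mat k nc"
    and ker: "mat_kernel F \<subseteq> mat_kernel A"
  shows "rank A \<le> k"
proof (rule ccontr)
  assume "\<not> rank A \<le> k"
  obtain S where S: "maximal S (\<lambda>T. T \<subseteq> set (cols A) \<and> lin_indpt T)"
    using maximal_exists_superset[of "set (cols A)" "\<lambda>T. T \<subseteq> set (cols A) \<and> lin_indpt T" "{}"]
    by (auto simp: lin_dep_def)
  then have SA: "S \<subseteq> set (cols A)" and indpt: "lin_indpt S" by (auto simp: maximal_def)
  define m where "m = card S"
  have "k < m" using rank_card_indpt[OF A S] \<open>\<not> rank A \<le> k\<close> by (simp add: m_def)
  obtain ss where ss: "set ss = S" "distinct ss"
    using finite_distinct_list[of S] SA finite_subset by blast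
  have m: "length ss = m" using ss m_def distinct_card by metis
  have "\<forall>q<m. \<exists>l<nc. ss ! q = col A l"
  proof (intro allI impI)
    fix q assume "q < m"
    then have "ss ! q \<in> set (cols A)" using SA ss(1) m nth_mem by blast
    then show "\<exists>l<nc. ss ! q = col A l" using A by (auto simp: cols_def)
  qed
  then obtain J where J: "\<And>q. q < m \<Longrightarrow> J q < nc" "\<And>q. q < m \<Longrightarrow> ss ! q = col A (J q)" by metis
  have injJ: "inj_on J {..<m}"
    using J(2) ss(2) m by (auto simp: inj_on_def distinct_conv_nth) metis
  define B where "B = mat_of_cols n ss"
  \<comment> \<open>Column \<open>q\<close> of \<open>E\<close> is the unit vector at
    \<open>J q\<close>: multiplying by \<open>E\<close> on the right selects the chosen columns, and
    applying \<open>E\<close> to a vector puts its coefficients at their positions.\<close>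
  define E :: "'a mat" where "E = mat nc m (\<lambda>(l, q). if l = J q then 1 else 0)"
  have E: "E \<in> carrier_mat nc m" by (simp add: E_def)
  have ssn: "set ss \<subseteq> carrier_vec n" using ss SA A cols_dim by blast
  have B: "B \<in> carrier_mat n m" using mat_of_cols_carrier(1)[of n ss] m by (simp add: B_def)
  have colsB: "cols B = ss" using ssn by (simp add: B_def)
  have BAE: "B = A * E"
  proof (rule eq_matI)
    fix i q assume "i < dim_row (A * E)" "q < dim_col (A * E)"
    then have iq: "i < n" "q < m" using A E by auto
    have "(A * E) $$ (i, q) = (\<Sum>l\<in>{0..<nc}. A $$ (i, l) * (if l = J q then 1 else 0))"
      using iq A by (simp add: E_def scalar_prod_def)
    also have "\<dots> = A $$ (i, J q)" using J(1)[OF iq(2)] by (simp add: if_distrib cong: if_cong)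
    also have "\<dots> = B $$ (i, q)"
      using iq A m J[OF iq(2)] by (simp add: B_def mat_of_cols_index)
    finally show "B $$ (i, q) = (A * E) $$ (i, q)" ..
  qed (use A B E in auto)
  obtain v where v: "v \<in> carrier_vec m" "v \<noteq> 0\<^sub>v m" "(F * E) *\<^sub>v v = 0\<^sub>v k"
    using wide_mat_kernel_nontrivial[of "F * E" k m] F E \<open>k < m\<close> by auto
  then have "E *\<^sub>v v \<in> mat_kernel F" using F E v by (auto simp: mat_kernel_def)
  with ker have "A *\<^sub>v (E *\<^sub>v v) = 0\<^sub>v n" using A by (auto simp: mat_kernel_def)
  then have "B *\<^sub>v v = 0\<^sub>v n" using A E v(1) by (simp add: BAE)
  from lin_depI[OF B v(1,2) this] have "lin_dep S" using colsB ss by simp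
  with indpt show False by simp
qed

text \<open>This trades submatrix indexing for vectors of full length: a vector indexed by the
  selected columns is extended by zero outside \<open>J\<close>, and the hypothesis
  \<open>ker\<close> then kills the rows in \<open>I\<close>.\<close>

lemma mat_rank_submatrix_le:
  assumes A: "A \<in> carrier_mat nr nc" and F: "F \<in> carrier_mat k nc"
    and ker: "\<And>c i. \<lbrakk>c \<in> carrier_vec nc; \<And>l. \<lbrakk>l < nc; l \<notin> J\<rbrakk> \<Longrightarrow> c $ l = 0; F *\<^sub>v c = 0\<^sub>v k;
                i < nr; i \<in> I\<rbrakk> \<Longrightarrow> (A *\<^sub>v c) $ i = 0"
  shows "mat_rank (submatrix A I J) \<le> k"
proof -
  define M where "M = submatrix A I J"
  define m where "m = card {l. l < nc \<and> l \<in> J}"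
  define E :: "real mat" where "E = mat nc m (\<lambda>(l, q). if l = pick J q then 1 else 0)"
  have E: "E \<in> carrier_mat nc m" by (simp add: E_def)
  have dr: "dim_row M = card {i. i < nr \<and> i \<in> I}" using A by (simp add: M_def dim_submatrix)
  have M: "M \<in> carrier_mat (dim_row M) m"
    using A by (intro carrier_matI) (simp_all add: M_def m_def dim_submatrix)
  have pJ: "pick J q < nc" "pick J q \<in> J" if "q < m" for q
  proof -
    show "pick J q < nc" using that pick_le unfolding m_def by blast
    \<comment> \<open>\<open>J\<close> may be infinite or reach beyond \<open>nc\<close>, while
      \<open>m\<close> counts only its members below \<open>nc\<close>; both cases of
      \<open>pick_in_set\<close> have to be covered.\<close>
    have "q < card J \<or> infinite J"
      using that card_mono[of J "{l. l < nc \<and> l \<in> J}"] unfolding m_def by fastforce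
    then show "pick J q \<in> J" by (rule pick_in_set)
  qed
  have pI: "pick I q < nr" "pick I q \<in> I" if "q < dim_row M" for q
  proof -
    show "pick I q < nr" using that pick_le unfolding dr by blast
    have "q < card I \<or> infinite I"
      using that card_mono[of I "{l. l < nr \<and> l \<in> I}"] unfolding dr by fastforce
    then show "pick I q \<in> I" by (rule pick_in_set)
  qed
  have ME: "M $$ (a, q) = (A * E) $$ (pick I a, q)" if "a < dim_row M" "q < m" for a q
  proof -
    have "(A * E) $$ (pick I a, q)
        = (\<Sum>l\<in>{0..<nc}. A $$ (pick I a, l) * (if l = pick J q then 1 else 0))"
      using that A pI(1) by (simp add: E_def scalar_prod_def)
    also have "\<dots> = A $$ (pick I a, pick J q)"
      using pJ(1)[OF that(2)] by (simp add: if_distrib cong: if_cong)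
    also have "\<dots> = M $$ (a, q)" 
      using that A unfolding M_def by (subst submatrix_index) (auto simp: dr[unfolded M_def] m_def dim_submatrix)
    finally show ?thesis ..
  qed
  have "mat_kernel (F * E) \<subseteq> mat_kernel M"
  proof
    fix v assume "v \<in> mat_kernel (F * E)"
    then have v: "v \<in> carrier_vec m" "(F * E) *\<^sub>v v = 0\<^sub>v k"
      using F E by (auto simp: mat_kernel_def)
    have c0: "(E *\<^sub>v v) $ l = 0" if "l < nc" "l \<notin> J" for l
    proof -
      have "(E *\<^sub>v v) $ l = (\<Sum>q\<in>{0..<m}. (if l = pick J q then 1 else 0) * v $ q)"
        using that v(1) by (simp add: E_def scalar_prod_def)
      also have "\<dots> = 0" using pJ(2) that(2) by (intro sum.neutral) auto
      finally show ?thesis .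
    qed
    have "M *\<^sub>v v = 0\<^sub>v (dim_row M)"
    proof (rule eq_vecI)
      fix a assume "a < dim_vec (0\<^sub>v (dim_row M) :: real vec)"
      then have a: "a < dim_row M" by simp
      have "(M *\<^sub>v v) $ a = (\<Sum>q\<in>{0..<m}. M $$ (a, q) * v $ q)"
        by (rule index_mult_mat_vec_sum[OF M v(1) a])
      also have "\<dots> = (\<Sum>q\<in>{0..<m}. (A * E) $$ (pick I a, q) * v $ q)"
        by (rule sum.cong[OF refl]) (simp only: ME[OF a] atLeastLessThan_iff)
      also have "\<dots> = ((A * E) *\<^sub>v v) $ pick I a"
        by (rule index_mult_mat_vec_sum[OF mult_carrier_mat[OF A E] v(1) pI(1)[OF a], symmetric])
      also have "\<dots> = (A *\<^sub>v (E *\<^sub>v v)) $ pick I a" using A E v(1) by simp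
      also have "\<dots> = 0"
        using ker[of "E *\<^sub>v v" "pick I a"] c0 pI[OF a] F E v by auto
      finally show "(M *\<^sub>v v) $ a = 0\<^sub>v (dim_row M) $ a" using a by simp
    qed simp
    with M v(1) show "v \<in> mat_kernel M" by (rule mat_kernelI)
  qed
  then show ?thesis
    unfolding mat_rank_def M_def[symmetric]
    by (rule vec_space.rank_le_of_mat_kernel_subset[OF M mult_carrier_mat[OF F E]])
qed

section \<open>States as linear functions of the input\<close>

lemma vsum_eq_zero:
  assumes "finite F" "\<And>j. j \<in> F \<Longrightarrow> f j = 0\<^sub>v d"
  shows "vsum d f F = 0\<^sub>v d"
  using assms
proof (induction F)
  case (insert j F)
  then show ?case by (subst finsum_vec_insert) auto
qed (simp add: finsum_vec_empty)

text \<open>The recursion is linear, so its solution at \<open>i\<close> is a fixed matrix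
  \<open>T i\<close> applied to the input. Well-founded recursion on these matrices yields existence
  of the states and their linearity at once.\<close>

lemma linear_recursion_transfer_matrices:
  fixes K :: "nat \<Rightarrow> real mat" and W :: "nat \<Rightarrow> nat \<Rightarrow> real mat"
  assumes wf: "wf R" and pre: "\<And>i. finite (pre i)" "\<And>i j. j \<in> pre i \<Longrightarrow> (j, i) \<in> R"
    and K: "\<And>i. i \<in> X \<Longrightarrow> K i \<in> carrier_mat (d i) M"
    and W: "\<And>i j. i \<in> X \<Longrightarrow> j \<in> pre i \<Longrightarrow> W i j \<in> carrier_mat (d i) (d j)"
  obtains T where "\<And>i. T i \<in> carrier_mat (d i) M"
    and "\<And>i c. i \<in> X \<Longrightarrow> c \<in> carrier_vec M \<Longrightarrow>
           T i *\<^sub>v c = K i *\<^sub>v c + vsum (d i) (\<lambda>j. W i j *\<^sub>v (T j *\<^sub>v c)) (pre i)"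
proof -
  \<comment> \<open>The entrywise form gives \<open>T i\<close> the dimensions \<open>d i\<close> by
    \<open>M\<close> for every \<open>i\<close>, also outside \<open>X\<close>, where
    \<open>K\<close> and \<open>W\<close> are unconstrained.\<close>
  define \<Phi> where "\<Phi> T i = mat (d i) M (\<lambda>(a, l). K i $$ (a, l) + (\<Sum>j\<in>pre i. (W i j * T j) $$ (a, l)))"
    for T i
  define T where "T = wfrec R \<Phi>"
  have T_eq: "T i = \<Phi> T i" for i
  proof -
    \<comment> \<open>Cutting \<open>T\<close> to the predecessors of \<open>i\<close> changes
      nothing, since \<Phi> evaluates it only on \<open>pre i\<close>.\<close>
    have "T i = \<Phi> (cut T R i) i" unfolding T_def by (subst wfrec[OF wf]) simp
    also have "\<dots> = \<Phi> T i" unfolding \<Phi>_def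
      by (intro cong_mat) (auto intro!: sum.cong simp: cut_apply pre(2))
    finally show ?thesis .
  qed
  have T: "T i \<in> carrier_mat (d i) M" for i by (subst T_eq) (simp add: \<Phi>_def)
  show thesis
  proof (rule that[OF T])
    fix i and c :: "real vec" assume i: "i \<in> X" and c: "c \<in> carrier_vec M"
    have Wc: "W i j *\<^sub>v (T j *\<^sub>v c) \<in> carrier_vec (d i)" if "j \<in> pre i" for j
      using W[OF i that] T by (metis mult_mat_vec_carrier c)
    then have vs: "vsum (d i) (\<lambda>j. W i j *\<^sub>v (T j *\<^sub>v c)) (pre i) \<in> carrier_vec (d i)"
      by (intro finsum_vec_closed) auto
    show "T i *\<^sub>v c = K i *\<^sub>v c + vsum (d i) (\<lambda>j. W i j *\<^sub>v (T j *\<^sub>v c)) (pre i)"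
    proof (rule eq_vecI)
      fix a assume "a < dim_vec (K i *\<^sub>v c + vsum (d i) (\<lambda>j. W i j *\<^sub>v (T j *\<^sub>v c)) (pre i))"
      with vs have a: "a < d i" by simp
      have WT: "(W i j *\<^sub>v (T j *\<^sub>v c)) $ a = (\<Sum>l\<in>{0..<M}. (W i j * T j) $$ (a, l) * c $ l)"
        if "j \<in> pre i" for j
      proof -
        have eq: "W i j *\<^sub>v (T j *\<^sub>v c) = (W i j * T j) *\<^sub>v c"
          using W[OF i that] T[of j] c by (rule assoc_mult_mat_vec[symmetric])
        show ?thesis unfolding eq using W[OF i that] T[of j] c a
          by (simp add: scalar_prod_def del: assoc_mult_mat_vec)
      qed
      have "(T i *\<^sub>v c) $ a = (\<Sum>l\<in>{0..<M}. T i $$ (a, l) * c $ l)"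
        using T[of i] c a by (simp add: scalar_prod_def)
      also have "\<dots> = (\<Sum>l\<in>{0..<M}. K i $$ (a, l) * c $ l
                        + (\<Sum>j\<in>pre i. (W i j * T j) $$ (a, l) * c $ l))"
        using a by (subst T_eq) (simp add: \<Phi>_def distrib_right sum_distrib_right)
      also have "\<dots> = (K i *\<^sub>v c) $ a + (\<Sum>j\<in>pre i. (W i j *\<^sub>v (T j *\<^sub>v c)) $ a)"
        using K[OF i] c a
        by (simp add: scalar_prod_def sum.distrib WT sum.swap[of _ "{0..<M}" "pre i"])
      also have "\<dots> = (K i *\<^sub>v c) $ a + vsum (d i) (\<lambda>j. W i j *\<^sub>v (T j *\<^sub>v c)) (pre i) $ a"
        using Wc by (subst index_finsum_vec[OF pre(1) a]) auto
      finally show "(T i *\<^sub>v c) $ a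
          = (K i *\<^sub>v c + vsum (d i) (\<lambda>j. W i j *\<^sub>v (T j *\<^sub>v c)) (pre i)) $ a"
        using a vs by simp
    qed (use T[of i] vs in simp)
  qed
qed

section \<open>Index arithmetic of the block partition\<close>

definition block_offset :: "(nat \<Rightarrow> nat) \<Rightarrow> nat \<Rightarrow> nat" where
  "block_offset N i = (\<Sum>k\<in>{1..<i}. N k)"

text \<open>The case \<open>i = 0\<close> is excluded because both sums in
  \<open>block_indices\<close> are then empty, whereas the interval on the right has length
  \<open>N 0\<close>.\<close>

lemma block_indices_offset:
  "1 \<le> i \<Longrightarrow> block_indices N i = {block_offset N i ..< block_offset N i + N i}"
  by (cases i) (simp_all add: block_indices_def block_offset_def atLeastLessThanSuc_atLeastAtMost
    flip: sum.atLeastLessThan_Suc)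

lemma block_offset_add_le:
  assumes "1 \<le> i" "i < j"
  shows "block_offset N i + N i \<le> block_offset N j"
proof -
  have "block_offset N i + N i = (\<Sum>k\<in>{1..<Suc i}. N k)"
    using assms by (simp add: block_offset_def)
  also have "\<dots> \<le> (\<Sum>k\<in>{1..<j}. N k)" using assms by (intro sum_mono2) auto
  finally show ?thesis by (simp add: block_offset_def)
qed

lemma block_indices_subset:
  assumes "1 \<le> i" "i \<le> n"
  shows "block_indices N i \<subseteq> {..<\<Sum>k\<in>{1..n}. N k}"
  using assms block_offset_add_le[of i "Suc n" N]
  by (auto simp: block_indices_offset block_offset_def atLeastLessThanSuc_atLeastAtMost)

lemma block_indices_disjoint:
  assumes "1 \<le> i" "1 \<le> j" "i \<noteq> j"
  shows "block_indices N i \<inter> block_indices N j = {}"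
proof (cases "i < j")
  case True
  then show ?thesis using block_offset_add_le[of i j N] assms by (auto simp: block_indices_offset)
next
  case False
  then show ?thesis using block_offset_add_le[of j i N] assms by (auto simp: block_indices_offset)
qed

text \<open>Induction on the number of blocks: the last block is an interval starting at the total
  size of the earlier ones, and shifting it to 0 gives the inner sum.\<close>

lemma sum_over_blocks:
  fixes f :: "nat \<Rightarrow> 'a :: comm_monoid_add"
  shows "(\<Sum>l\<in>{0..<\<Sum>k\<in>{1..n}. N k}. f l) = (\<Sum>j\<in>{1..n}. \<Sum>b\<in>{0..<N j}. f (block_offset N j + b))"
proof (induction n)
  case (Suc n)
  let ?M = "\<Sum>k\<in>{1..n}. N k"
  have off: "block_offset N (Suc n) = ?M"
    by (simp add: block_offset_def atLeastLessThanSuc_atLeastAtMost)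
  have "(\<Sum>l\<in>{0..<\<Sum>k\<in>{1..Suc n}. N k}. f l) = (\<Sum>l\<in>{0..<?M + N (Suc n)}. f l)"
    by simp
  also have "\<dots> = (\<Sum>l\<in>{0..<?M}. f l) + (\<Sum>l\<in>{?M..<?M + N (Suc n)}. f l)"
    by (rule sum.atLeastLessThan_concat[symmetric]) simp_all
  also have "(\<Sum>l\<in>{?M..<?M + N (Suc n)}. f l)
      = (\<Sum>b\<in>{0..<N (Suc n)}. f (block_offset N (Suc n) + b))"
    using sum.shift_bounds_nat_ivl[of f 0 ?M "N (Suc n)"] unfolding off
    by (simp only: add.commute add_0)
  also note Suc.IH
  finally show ?case by (simp only: sum.cl_ivl_Suc) simp
qed simp

text \<open>Exactly \<open>a\<close> elements of the interval lie below \<open>m + a\<close>, and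
  \<open>pick_card_in_set\<close> recovers an element from that count.\<close>

lemma pick_interval: "a < d \<Longrightarrow> pick {m..<m + d} a = m + a"
proof -
  assume "a < d"
  then have "{x \<in> {m..<m + d}. x < m + a} = {m..<m + a}" by auto
  with pick_card_in_set[of "m + a" "{m..<m + d}"] \<open>a < d\<close> show ?thesis by simp
qed

lemma block_eq_mat:
  assumes A: "A \<in> carrier_mat (\<Sum>k\<in>{1..n}. N k) (\<Sum>k\<in>{1..n}. N k)"
    and ij: "i \<in> {1..n}" "j \<in> {1..n}"
  shows "block N A i j
    = mat (N i) (N j) (\<lambda>(a, b). A $$ (block_offset N i + a, block_offset N j + b))"
proof -
  have card: "card {x. x < (\<Sum>k\<in>{1..n}. N k) \<and> x \<in> block_indices N i} = N i"
    if "i \<in> {1..n}" for i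
  proof -
    have "{x. x < (\<Sum>k\<in>{1..n}. N k) \<and> x \<in> block_indices N i} = block_indices N i"
      using block_indices_subset[of i n N] that by auto
    then show ?thesis using that by (simp only:) (simp add: block_indices_offset)
  qed
  have pick: "pick (block_indices N i) a = block_offset N i + a" if "i \<in> {1..n}" "a < N i" for i a
    using that by (simp add: block_indices_offset pick_interval)
  show ?thesis
    unfolding block_def submatrix_def carrier_matD[OF A] card[OF ij(1)] card[OF ij(2)]
    by (intro cong_mat refl) (simp add: pick[OF ij(1)] pick[OF ij(2)])
qed

text \<open>Extracting the piece belonging to vertex \<open>i\<close> by a matrix makes the local
  input a linear function of the full input vector, so that it can enter the transfer
  matrices.\<close>

definition block_selection :: "(nat \<Rightarrow> nat) \<Rightarrow> nat \<Rightarrow> nat \<Rightarrow> real mat" where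
  "block_selection N M i = mat (N i) M (\<lambda>(a, l). if l = block_offset N i + a then 1 else 0)"

lemma block_selection_carrier [simp]: "block_selection N M i \<in> carrier_mat (N i) M"
  by (simp add: block_selection_def)

lemma block_selection_mult_vec_index:
  assumes "c \<in> carrier_vec M" "a < N i" "block_offset N i + a < M"
  shows "(block_selection N M i *\<^sub>v c) $ a = c $ (block_offset N i + a)"
proof -
  have "(block_selection N M i *\<^sub>v c) $ a
      = (\<Sum>l\<in>{0..<M}. (if l = block_offset N i + a then 1 else 0) * c $ l)"
    using assms by (simp add: block_selection_def scalar_prod_def)
  also have "\<dots> = c $ (block_offset N i + a)"
    using assms(3) by (simp add: if_distrib[of "\<lambda>x. x * _"] cong: if_cong)
  finally show ?thesis .
qed

text \<open>This connects an entry of the full product with the block sum in the definition of a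
  representation: the sum over columns is split by \<open>sum_over_blocks\<close>, and each inner
  sum is a row of a block times a selected piece.\<close>

lemma mult_vec_block_index:
  fixes N :: "nat \<Rightarrow> nat" and n :: nat
  defines "M \<equiv> \<Sum>k\<in>{1..n}. N k"
  assumes A: "A \<in> carrier_mat M M" and c: "c \<in> carrier_vec M"
    and i: "i \<in> {1..n}" and a: "a < N i"
  shows "(A *\<^sub>v c) $ (block_offset N i + a)
       = vsum (N i) (\<lambda>j. block N A i j *\<^sub>v (block_selection N M j *\<^sub>v c)) {1..n} $ a"
proof -
  have lt: "block_offset N j + b < M" if "j \<in> {1..n}" "b < N j" for j b
  proof -
    have "block_offset N j + b \<in> block_indices N j" using that by (simp add: block_indices_offset)
    then show ?thesis using block_indices_subset[of j n N] that unfolding M_def by auto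
  qed
  have blk: "block N A i j = mat (N i) (N j) (\<lambda>(a, b). A $$ (block_offset N i + a, block_offset N j + b))"
    if "j \<in> {1..n}" for j
    using block_eq_mat[OF A[unfolded M_def] i that] .
  have term_eq: "(block N A i j *\<^sub>v (block_selection N M j *\<^sub>v c)) $ a
      = (\<Sum>b\<in>{0..<N j}. A $$ (block_offset N i + a, block_offset N j + b) * c $ (block_offset N j + b))"
    if j: "j \<in> {1..n}" for j
  proof -
    have "(block N A i j *\<^sub>v (block_selection N M j *\<^sub>v c)) $ a
      = (\<Sum>b\<in>{0..<N j}. block N A i j $$ (a, b) * (block_selection N M j *\<^sub>v c) $ b)"
      by (rule index_mult_mat_vec_sum[of _ "N i"]) (simp_all add: a blk[OF j] mult_mat_vec_carrier[OF block_selection_carrier c])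
    also have "\<dots> = (\<Sum>b\<in>{0..<N j}. A $$ (block_offset N i + a, block_offset N j + b)
                                  * c $ (block_offset N j + b))"
      using a c lt[OF j] by (intro sum.cong) (auto simp: blk[OF j] block_selection_mult_vec_index)
    finally show ?thesis .
  qed
  have "(A *\<^sub>v c) $ (block_offset N i + a) = (\<Sum>l\<in>{0..<M}. A $$ (block_offset N i + a, l) * c $ l)"
    using A c lt[OF i a] by (simp add: scalar_prod_def)
  also have "\<dots> = (\<Sum>j\<in>{1..n}. \<Sum>b\<in>{0..<N j}.
      A $$ (block_offset N i + a, block_offset N j + b) * c $ (block_offset N j + b))"
    unfolding M_def by (rule sum_over_blocks)
  also have "\<dots> = (\<Sum>j\<in>{1..n}. (block N A i j *\<^sub>v (block_selection N M j *\<^sub>v c)) $ a)"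
    using term_eq by simp
  also have "\<dots> = vsum (N i) (\<lambda>j. block N A i j *\<^sub>v (block_selection N M j *\<^sub>v c)) {1..n} $ a"
    by (rule index_finsum_vec[symmetric]) (auto simp: a blk intro!: carrier_vecI)
  finally show ?thesis .
qed

section \<open>Recursion along the Hamiltonian path\<close>

lemma wf_before:
  assumes "distinct p"
  shows "wf {(i, j). before p i j}" "wf {(j, i). before p i j}"
proof -
  \<comment> \<open>Positions are unique because \<open>p\<close> is distinct. The first relation
    decreases the position, the reversed one decreases the distance to the end of
    \<open>p\<close>.\<close>
  define pos where "pos x = (THE k. k < length p \<and> p ! k = x)" for x
  have pos: "pos (p ! k) = k" if "k < length p" for k
    unfolding pos_def using that assms nth_eq_iff_index_eq by (intro the_equality) auto
  have "{(i, j). before p i j} \<subseteq> Wellfounded.measure pos"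
    by (auto simp: before_def pos)
  then show "wf {(i, j). before p i j}" by (rule wf_subset[OF wf_measure])
  have "{(j, i). before p i j} \<subseteq> Wellfounded.measure (\<lambda>x. length p - pos x)"
    by (auto simp: before_def pos)
  then show "wf {(j, i). before p i j}" by (rule wf_subset[OF wf_measure])
qed

text \<open>\<open>Y\<close> will be the set of vertices outside \<open>H\<close>, and the explicit
  zero vector in \<open>s\<close> is the vanished input term. Each predecessor is either in
  \<open>Y\<close>, where induction applies, or a boundary vertex, where \<open>bd\<close>
  applies.\<close>

lemma recursion_vanishes:
  assumes "wf R" and pre: "\<And>i. finite (pre i)" "\<And>i j. j \<in> pre i \<Longrightarrow> (j, i) \<in> R"
    and W: "\<And>i j. i \<in> Y \<Longrightarrow> j \<in> pre i \<Longrightarrow> W i j \<in> carrier_mat (d i) (d j)"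
    and s: "\<And>i. i \<in> Y \<Longrightarrow> s i = 0\<^sub>v (d i) + vsum (d i) (\<lambda>j. W i j *\<^sub>v s j) (pre i)"
    and bd: "\<And>i j. i \<in> Y \<Longrightarrow> j \<in> pre i \<Longrightarrow> j \<notin> Y \<Longrightarrow> s j = 0\<^sub>v (d j)"
    and "i \<in> Y"
  shows "s i = 0\<^sub>v (d i)"
  using \<open>wf R\<close> \<open>i \<in> Y\<close>
proof (induction i rule: wf_induct_rule)
  case (less i)
  have "W i j *\<^sub>v s j = 0\<^sub>v (d i)" if j: "j \<in> pre i" for j
  proof -
    have "s j = 0\<^sub>v (d j)" using less bd j pre(2) by blast
    then show ?thesis using mult_mat_zero_vec[OF W[OF less.prems j]] by simp
  qed
  then have "vsum (d i) (\<lambda>j. W i j *\<^sub>v s j) (pre i) = 0\<^sub>v (d i)"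
    by (rule vsum_eq_zero[OF pre(1)])
  then show ?case using s[OF less.prems] by simp
qed

section \<open>The off-diagonal rank is bounded by the boundary states\<close>

text \<open>\<open>mat_rank_submatrix_le\<close> is applied with the map \<open>F\<close> from
  inputs to all states at \<open>Bd\<close>. A vertex of \<open>Bd\<close> contributes its state
  dimensions once, however many cut edges it meets.\<close>

lemma rank_block_submatrix_le:
  fixes G :: "nat pair_pre_digraph" and N :: "nat \<Rightarrow> nat" and A :: "real mat" and H :: "nat set"
  assumes gpm: "graph_partitioned_matrix n G N A"
    and ssr: "semi_separable_representation n G N A p rg rh V W Q R D U P"
    and H: "H \<subseteq> {1..n}"
  defines "Bd \<equiv> {i \<in> H. \<exists>j \<in> {1..n} - H. (i, j) \<in> parcs G}"
  shows "mat_rank (block_submatrix N A ({1..n} - H) H) \<le> (\<Sum>i\<in>Bd. rg i + rh i)"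
proof -
  define M where "M = (\<Sum>k\<in>{1..n}. N k)"
  interpret pair_graph G using gpm by (simp add: graph_partitioned_matrix_def)
  have verts: "pverts G = {1..n}" and A: "A \<in> carrier_mat M M"
    using gpm by (simp_all add: graph_partitioned_matrix_def M_def)
  have "distinct p"
    using ssr by (simp add: semi_separable_representation_def hamiltonian_path_def vpath_def)
  note wf = wf_before[OF this]
  have nbr: "j \<in> {1..n}" if "(i, j) \<in> parcs G" for i j
    using that in_arcsD2 verts by auto
  \<comment> \<open>The recursion for \<open>g\<close> refers to later vertices and that for
    \<open>h\<close> to earlier ones, so the former uses the reversed path order.\<close>
  have Pd: "finite (P_d G p i)" "j \<in> P_d G p i \<Longrightarrow> (j, i) \<in> {(j, i). before p i j}"
    and Pu: "finite (P_u G p i)" "j \<in> P_u G p i \<Longrightarrow> (j, i) \<in> {(i, j). before p i j}" for i j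
    using nbr by (auto simp: P_d_def P_u_def intro: finite_subset[of _ "{1..n}"])
  have mats: "V i \<in> carrier_mat (N i) (rg i)" "Q i \<in> carrier_mat (N i) (rh i)"
      "D i \<in> carrier_mat (N i) (N i)"
    and mats_d: "j \<in> P_d G p i \<Longrightarrow> W i j \<in> carrier_mat (rg i) (rg j)"
      "j \<in> P_d G p i \<Longrightarrow> U i j \<in> carrier_mat (N i) (rg j)"
    and mats_u: "j \<in> P_u G p i \<Longrightarrow> R i j \<in> carrier_mat (rh i) (rh j)"
      "j \<in> P_u G p i \<Longrightarrow> P i j \<in> carrier_mat (N i) (rh j)"
    if "i \<in> {1..n}" for i j
    using ssr that by (simp_all add: semi_separable_representation_def)
  have repr: "\<And>x g h b.
        (\<forall>i\<in>{1..n}.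
           x i \<in> carrier_vec (N i) \<and> g i \<in> carrier_vec (rg i) \<and>
           h i \<in> carrier_vec (rh i) \<and> b i \<in> carrier_vec (N i)) \<Longrightarrow>
        (\<forall>i\<in>{1..n}.
           g i = (V i)\<^sup>T *\<^sub>v x i + vsum (rg i) (\<lambda>j. W i j *\<^sub>v g j) (P_d G p i) \<and>
           h i = (Q i)\<^sup>T *\<^sub>v x i + vsum (rh i) (\<lambda>j. R i j *\<^sub>v h j) (P_u G p i) \<and>
           b i = D i *\<^sub>v x i + vsum (N i) (\<lambda>j. U i j *\<^sub>v g j) (P_d G p i)
                             + vsum (N i) (\<lambda>j. P i j *\<^sub>v h j) (P_u G p i)) \<Longrightarrow>
        (\<forall>i\<in>{1..n}. b i = vsum (N i) (\<lambda>j. block N A i j *\<^sub>v x j) {1..n})"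
    using ssr unfolding semi_separable_representation_def by blast
  define E where "E = block_selection N M"
  have E: "E i \<in> carrier_mat (N i) M" for i by (simp add: E_def)
  have VE: "(V i)\<^sup>T * E i \<in> carrier_mat (rg i) M" and QE: "(Q i)\<^sup>T * E i \<in> carrier_mat (rh i) M"
    if "i \<in> {1..n}" for i
    using mats[OF that] E by auto
  \<comment> \<open>\<open>S i\<close> sends the full input vector to the state \<open>g\<close> at
    \<open>i\<close>; \<open>T i\<close> below does the same for \<open>h\<close>.\<close>
  obtain S where S: "\<And>i. S i \<in> carrier_mat (rg i) M"
    and S_eq: "\<And>i c. i \<in> {1..n} \<Longrightarrow> c \<in> carrier_vec M \<Longrightarrow> S i *\<^sub>v c
      = ((V i)\<^sup>T * E i) *\<^sub>v c + vsum (rg i) (\<lambda>j. W i j *\<^sub>v (S j *\<^sub>v c)) (P_d G p i)"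
    by (rule linear_recursion_transfer_matrices[where X = "{1..n}" and pre = "P_d G p" and d = rg and M = M
          and K = "\<lambda>i. (V i)\<^sup>T * E i" and W = W, OF wf(2)]) (rule Pd VE mats_d(1) that; assumption)+
  obtain T where T: "\<And>i. T i \<in> carrier_mat (rh i) M"
    and T_eq: "\<And>i c. i \<in> {1..n} \<Longrightarrow> c \<in> carrier_vec M \<Longrightarrow> T i *\<^sub>v c
      = ((Q i)\<^sup>T * E i) *\<^sub>v c + vsum (rh i) (\<lambda>j. R i j *\<^sub>v (T j *\<^sub>v c)) (P_u G p i)"
    by (rule linear_recursion_transfer_matrices[where X = "{1..n}" and pre = "P_u G p" and d = rh and M = M
          and K = "\<lambda>i. (Q i)\<^sup>T * E i" and W = R, OF wf(1)]) (rule Pu QE mats_u(1) that; assumption)+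
  have fin: "finite Bd" unfolding Bd_def using H finite_subset[of H "{1..n}"] by simp
  \<comment> \<open>All rows of the boundary transfer matrices are stacked, so \<open>F\<close>
    annihilates an input exactly when every boundary state vanishes.\<close>
  define Fl where "Fl = concat (map (\<lambda>j. rows (S j) @ rows (T j)) (sorted_list_of_set Bd))"
  define F where "F = mat_of_rows M Fl"
  have len: "length Fl = (\<Sum>i\<in>Bd. rg i + rh i)"
  proof -
    have "length Fl = sum_list (map (\<lambda>j. rg j + rh j) (sorted_list_of_set Bd))"
      using carrier_matD(1)[OF S] carrier_matD(1)[OF T]
      by (simp add: Fl_def length_concat comp_def)
    also have "\<dots> = (\<Sum>i\<in>Bd. rg i + rh i)"
      using fin by (simp add: sum_list_distinct_conv_sum_set)
    finally show ?thesis .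
  qed
  have Fl: "set Fl = (\<Union>j\<in>Bd. set (rows (S j)) \<union> set (rows (T j)))"
    using fin by (simp add: Fl_def)
  have rowsM: "set (rows B) \<subseteq> carrier_vec M" if "B \<in> carrier_mat k M" for B :: "real mat" and k
    using that by (auto simp: rows_def)
  have Fl_carrier: "set Fl \<subseteq> carrier_vec M" unfolding Fl using rowsM[OF S] rowsM[OF T] by blast
  have F: "F \<in> carrier_mat (\<Sum>i\<in>Bd. rg i + rh i) M"
    using mat_of_rows_carrier(1)[of M Fl] by (simp add: F_def len)
  show ?thesis unfolding block_submatrix_def
  proof (rule mat_rank_submatrix_le[OF A F])
    fix c l
    assume c: "c \<in> carrier_vec M"
      and supp: "\<And>l. l < M \<Longrightarrow> l \<notin> \<Union> (block_indices N ` H) \<Longrightarrow> c $ l = 0"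
      and Fc: "F *\<^sub>v c = 0\<^sub>v (\<Sum>i\<in>Bd. rg i + rh i)"
      and l: "l < M" "l \<in> \<Union> (block_indices N ` ({1..n} - H))"
    have Fl_zero: "w \<bullet> c = 0" if w: "w \<in> set Fl" for w
    proof -
      obtain q where q: "q < length Fl" "w = Fl ! q" using w unfolding in_set_conv_nth by blast
      then have "row F q = w" using w Fl_carrier unfolding F_def by (subst mat_of_rows_row) auto
      then show ?thesis using arg_cong[OF Fc, of "\<lambda>u. u $ q"] q F len by simp
    qed
    have rows_zero: "B *\<^sub>v c = 0\<^sub>v k" if "B \<in> carrier_mat k M" "set (rows B) \<subseteq> set Fl"
      for B :: "real mat" and k
    proof (rule eq_vecI)
      fix a assume "a < dim_vec (0\<^sub>v k :: real vec)"
      then have a: "a < dim_row B" using that by simp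
      then have "row B a \<in> set (rows B)" by (auto simp: rows_def)
      then show "(B *\<^sub>v c) $ a = 0\<^sub>v k $ a" using Fl_zero that a by auto
    qed (use that in simp)
    have Sb: "S j *\<^sub>v c = 0\<^sub>v (rg j)" and Tb: "T j *\<^sub>v c = 0\<^sub>v (rh j)" if "j \<in> Bd" for j
      using that S T by (auto intro!: rows_zero simp: Fl)
    \<comment> \<open>The input is supported on the indices of \<open>H\<close>, and blocks of
      distinct vertices are disjoint.\<close>
    have E0: "E i *\<^sub>v c = 0\<^sub>v (N i)" if i: "i \<in> {1..n} - H" for i
    proof (rule eq_vecI)
      fix a assume "a < dim_vec (0\<^sub>v (N i) :: real vec)"
      then have a: "a < N i" by simp
      let ?l = "block_offset N i + a"
      have il: "?l \<in> block_indices N i" using i a by (simp add: block_indices_offset)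
      then have lt: "?l < M" using block_indices_subset[of i n N] i by (auto simp: M_def)
      have "?l \<notin> \<Union> (block_indices N ` H)"
      proof
        assume "?l \<in> \<Union> (block_indices N ` H)"
        then obtain j where j: "j \<in> H" "?l \<in> block_indices N j" by blast
        with i H have "1 \<le> j" "i \<noteq> j" by auto
        with block_indices_disjoint[of i j N] i il j show False by auto
      qed
      then show "(E i *\<^sub>v c) $ a = 0\<^sub>v (N i) $ a"
        using a supp lt c by (simp add: E_def block_selection_mult_vec_index)
    qed (use E[of i] in simp)
    have VE0: "((V i)\<^sup>T * E i) *\<^sub>v c = 0\<^sub>v (rg i)" and QE0: "((Q i)\<^sup>T * E i) *\<^sub>v c = 0\<^sub>v (rh i)"
      if i: "i \<in> {1..n} - H" for i
    proof -
      have V: "(V i)\<^sup>T \<in> carrier_mat (rg i) (N i)" and Q: "(Q i)\<^sup>T \<in> carrier_mat (rh i) (N i)"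
        using mats i by auto
      show "((V i)\<^sup>T * E i) *\<^sub>v c = 0\<^sub>v (rg i)"
        unfolding assoc_mult_mat_vec[OF V E c] E0[OF i] by (rule mult_mat_zero_vec[OF V])
      show "((Q i)\<^sup>T * E i) *\<^sub>v c = 0\<^sub>v (rh i)"
        unfolding assoc_mult_mat_vec[OF Q E c] E0[OF i] by (rule mult_mat_zero_vec[OF Q])
    qed
    \<comment> \<open>The sets \<open>P_d\<close> and \<open>P_u\<close> provide an arc from the
      outside vertex \<open>i\<close> to \<open>j\<close>; symmetry reverses it into the arc leaving
      \<open>H\<close> that \<open>Bd\<close> asks for.\<close>
    have boundary: "j \<in> Bd"
      if "i \<in> {1..n} - H" "j \<in> P_d G p i \<union> P_u G p i" "j \<notin> {1..n} - H" for i j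
      using that nbr arcs_symmetric unfolding Bd_def P_d_def P_u_def by blast
    have S0: "S i *\<^sub>v c = 0\<^sub>v (rg i)" if "i \<in> {1..n} - H" for i
    proof (rule recursion_vanishes[where pre = "P_d G p" and Y = "{1..n} - H" and W = W and d = rg
          and s = "\<lambda>i. S i *\<^sub>v c", OF wf(2) Pd])
      show "S i *\<^sub>v c = 0\<^sub>v (rg i) + vsum (rg i) (\<lambda>j. W i j *\<^sub>v (S j *\<^sub>v c)) (P_d G p i)"
        if "i \<in> {1..n} - H" for i
        using S_eq[of i c] VE0[OF that] that c by simp
    qed (use that mats_d(1) boundary Sb in auto)
    have T0: "T i *\<^sub>v c = 0\<^sub>v (rh i)" if "i \<in> {1..n} - H" for i
    proof (rule recursion_vanishes[where pre = "P_u G p" and Y = "{1..n} - H" and W = R and d = rh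
          and s = "\<lambda>i. T i *\<^sub>v c", OF wf(1) Pu])
      show "T i *\<^sub>v c = 0\<^sub>v (rh i) + vsum (rh i) (\<lambda>j. R i j *\<^sub>v (T j *\<^sub>v c)) (P_u G p i)"
        if "i \<in> {1..n} - H" for i
        using T_eq[of i c] QE0[OF that] that c by simp
    qed (use that mats_u(1) boundary Tb in auto)
    obtain i where i: "i \<in> {1..n} - H" and li: "l \<in> block_indices N i" using l(2) by blast
    define a where "a = l - block_offset N i"
    have a: "a < N i" "l = block_offset N i + a"
      using li i by (auto simp: a_def block_indices_offset)
    \<comment> \<open>The inputs \<open>E i\<close> applied to \<open>c\<close>, the states from
      \<open>S\<close> and \<open>T\<close>, and this \<open>b\<close> satisfy the equations of the
      representation by construction, so \<open>repr\<close> identifies \<open>b\<close> with the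
      block product.\<close>
    define b where "b i = D i *\<^sub>v (E i *\<^sub>v c) + vsum (N i) (\<lambda>j. U i j *\<^sub>v (S j *\<^sub>v c)) (P_d G p i)
                             + vsum (N i) (\<lambda>j. P i j *\<^sub>v (T j *\<^sub>v c)) (P_u G p i)" for i
    have b_carrier: "b i \<in> carrier_vec (N i)" if "i \<in> {1..n}" for i
      unfolding b_def using mats(3)[OF that] mats_d(2)[OF that] mats_u(2)[OF that] E S T c
      by (intro add_carrier_vec finsum_vec_closed) (auto intro!: mult_mat_vec_carrier)
    have b_eq: "\<forall>i\<in>{1..n}. b i = vsum (N i) (\<lambda>j. block N A i j *\<^sub>v (E j *\<^sub>v c)) {1..n}"
    proof (rule repr[of _ "\<lambda>i. S i *\<^sub>v c" "\<lambda>i. T i *\<^sub>v c"])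
      show "\<forall>i\<in>{1..n}. E i *\<^sub>v c \<in> carrier_vec (N i) \<and> S i *\<^sub>v c \<in> carrier_vec (rg i)
          \<and> T i *\<^sub>v c \<in> carrier_vec (rh i) \<and> b i \<in> carrier_vec (N i)"
        using b_carrier E S T c by (auto intro!: mult_mat_vec_carrier)
      show "\<forall>i\<in>{1..n}.
           S i *\<^sub>v c = (V i)\<^sup>T *\<^sub>v (E i *\<^sub>v c) + vsum (rg i) (\<lambda>j. W i j *\<^sub>v (S j *\<^sub>v c)) (P_d G p i) \<and>
           T i *\<^sub>v c = (Q i)\<^sup>T *\<^sub>v (E i *\<^sub>v c) + vsum (rh i) (\<lambda>j. R i j *\<^sub>v (T j *\<^sub>v c)) (P_u G p i) \<and>
           b i = D i *\<^sub>v (E i *\<^sub>v c) + vsum (N i) (\<lambda>j. U i j *\<^sub>v (S j *\<^sub>v c)) (P_d G p i)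
                             + vsum (N i) (\<lambda>j. P i j *\<^sub>v (T j *\<^sub>v c)) (P_u G p i)"
      proof (intro ballI conjI)
        fix i assume i: "i \<in> {1..n}"
        show "S i *\<^sub>v c = (V i)\<^sup>T *\<^sub>v (E i *\<^sub>v c) + vsum (rg i) (\<lambda>j. W i j *\<^sub>v (S j *\<^sub>v c)) (P_d G p i)"
          using S_eq[OF i c] unfolding assoc_mult_mat_vec[OF transpose_carrier_mat[THEN iffD2, OF mats(1)[OF i]] E c] .
        show "T i *\<^sub>v c = (Q i)\<^sup>T *\<^sub>v (E i *\<^sub>v c) + vsum (rh i) (\<lambda>j. R i j *\<^sub>v (T j *\<^sub>v c)) (P_u G p i)"
          using T_eq[OF i c] unfolding assoc_mult_mat_vec[OF transpose_carrier_mat[THEN iffD2, OF mats(2)[OF i]] E c] .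
      qed (simp only: b_def)
    qed
    \<comment> \<open>A neighbour of \<open>i\<close> is either outside \<open>H\<close>, where the
      recursion gives zero, or in \<open>Bd\<close>, where \<open>F\<close> forces zero.\<close>
    have Sn: "S j *\<^sub>v c = 0\<^sub>v (rg j)" if "j \<in> P_d G p i" for j
      using that S0 Sb boundary i by blast
    have Tn: "T j *\<^sub>v c = 0\<^sub>v (rh j)" if "j \<in> P_u G p i" for j
      using that T0 Tb boundary i by blast
    have "vsum (N i) (\<lambda>j. U i j *\<^sub>v (S j *\<^sub>v c)) (P_d G p i) = 0\<^sub>v (N i)"
      using i by (intro vsum_eq_zero Pd(1)) (auto simp: Sn intro!: mult_mat_zero_vec mats_d(2))
    moreover have "vsum (N i) (\<lambda>j. P i j *\<^sub>v (T j *\<^sub>v c)) (P_u G p i) = 0\<^sub>v (N i)"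
      using i by (intro vsum_eq_zero Pu(1)) (auto simp: Tn intro!: mult_mat_zero_vec mats_u(2))
    moreover have "D i *\<^sub>v (E i *\<^sub>v c) = 0\<^sub>v (N i)"
      using i by (auto simp: E0 intro!: mult_mat_zero_vec mats(3))
    ultimately have "b i = 0\<^sub>v (N i)" by (simp add: b_def)
    then show "(A *\<^sub>v c) $ l = 0"
      using mult_vec_block_index[where A = A and n = n and N = N and c = c and i = i and a = a]
        A c i a b_eq by (simp add: E_def M_def)
  qed
qed

section \<open>Counting boundary vertices against cut edges\<close>

theorem proposition2p11:
  fixes n :: nat
    and G :: "nat pair_pre_digraph"
    and N :: "nat \<Rightarrow> nat"
    and A :: "real mat"
    and p :: "nat list"
    and rg rh :: "nat \<Rightarrow> nat"
    and V Q D :: "nat \<Rightarrow> real mat"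
    and W R U P :: "nat \<Rightarrow> nat \<Rightarrow> real mat"
    and r :: nat
  assumes "graph_partitioned_matrix n G N A"
    and "semi_separable_representation n G N A p rg rh V W Q R D U P"
    and "r = Max (rg ` {1..n} \<union> rh ` {1..n})"
  shows "GIRS G N A (4 * real r)"
  unfolding GIRS_def
proof (intro conjI allI impI)
  interpret pair_graph G using assms(1) by (simp add: graph_partitioned_matrix_def)
  have verts: "pverts G = {1..n}" using assms(1) by (simp add: graph_partitioned_matrix_def)
  fix H assume "induced_subgraph H (with_proj G)"
  then have H: "verts H \<subseteq> {1..n}" by (simp add: induced_subgraph_def subgraph_def verts)
  let ?B = "{i \<in> verts H. \<exists>j \<in> {1..n} - verts H. (i, j) \<in> parcs G}"
  let ?C = "{(i, j) \<in> parcs G. i \<in> verts H \<and> j \<in> pverts G - verts H}"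
  have "finite ?C" by (rule finite_subset[OF _ pair_finite_arcs]) auto
  \<comment> \<open>Each boundary vertex is the tail of an arc leaving \<open>H\<close>. Several
    such arcs may share a tail, so only an inequality of cardinalities results.\<close>
  moreover have "?B \<subseteq> fst ` ?C" by (force simp: verts)
  ultimately have card: "card ?B \<le> cut_edges G H"
    unfolding cut_edges_def by (meson card_image_le card_mono finite_imageI order_trans)
  have "rg i + rh i \<le> 2 * r" if "i \<in> ?B" for i
  proof -
    have "i \<in> {1..n}" using that H by auto
    then have "rg i \<le> r" "rh i \<le> r" unfolding assms(3) by (auto intro!: Max_ge)
    then show ?thesis by simp
  qed
  then have "(\<Sum>i\<in>?B. rg i + rh i) \<le> card ?B * (2 * r)"
    using sum_bounded_above[of ?B "\<lambda>i. rg i + rh i" "2 * r"] by simp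
  \<comment> \<open>One \<open>g\<close> and one \<open>h\<close> state per boundary vertex account
    for the factor \<open>2 * r\<close>, which is relaxed here to the \<open>4 * r\<close> of the
    claim.\<close>
  also have "\<dots> \<le> 4 * r * cut_edges G H"
    using mult_le_mono[OF card, of "2 * r" "4 * r"] by (simp add: mult.commute)
  finally have "mat_rank (block_submatrix N A (pverts G - verts H) (verts H)) \<le> 4 * r * cut_edges G H"
    using rank_block_submatrix_le[OF assms(1,2) H] by (simp add: verts)
  then have "real (mat_rank (block_submatrix N A (pverts G - verts H) (verts H)))
      \<le> real (4 * r * cut_edges G H)"
    by (simp only: of_nat_le_iff)
  then show "real (mat_rank (block_submatrix N A (pverts G - verts H) (verts H)))
      \<le> 4 * real r * real (cut_edges G H)"
    by simp
qed simp

end
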